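(* Let $\mathfrak{A}$ be a quasi-controllable family of real $N\times N$ matrices, and suppose that the difference equation $x(n+1)=A(n)x(n)$ is Lyapunov absolutely stable with respect to $\mathfrak{A}$. Then for each integer $p\ge N-1$ the inequality $$\chi(\mathfrak{A})\le \frac{1}{\sigma_p(\mathfrak{A})}$$ holds.
   Context: Let $\mathfrak{A}=\{A_1,\ldots,A_M\}$ be a finite family of real $N\times N$ matrices. It is called quasi-controllable if no nonzero proper subspace of $\mathbb{R}^N$ is invariant for all matrices from $\mathfrak{A}$. Fix a norm $\|\cdot\|$ on $\mathbb{R}^N$ and let $\mathbf{S}(t)$ be the ball of radius $t$ centered at $0$ in this norm. For $k=1,2,\ldots$ let $\mathfrak{A}_k$ be the set of finite products of matrices from $\mathfrak{A}\cup\{I\}$ containing no more than $k$ factors, and for $x\in\mathbb{R}^N$ let $\mathfrak{A}_k(x)=\{Lx: L\in\mathfrak{A}_k\}$. For $W\subseteq\mathbb{R}^N$ let $\mathrm{absco}(W)=\mathrm{co}(W\cup(-W))$, where $\mathrm{co}$ denotes the convex hull. The $p$-measure of quasi-controllability ($p\ge 1$ an integer) is $$\sigma_p(\mathfrak{A})=\inf_{x\in\mathbb{R}^N,\ \|x\|=1}\ \sup\{t:\ \mathbf{S}(t)\subseteq \mathrm{absco}(\mathfrak{A}_p(x))\}.$$ The equation $x(n+1)=A(n)x(n)$ is called Lyapunov absolutely stable with respect to $\mathfrak{A}$ if there exists $\mu<\infty$ such that for each sequence $A(n)\in\mathfrak{A}$, $n=0,1,2,\ldots$, any solution $x(\cdot)$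 of the corresponding equation satisfies $\sup_{n\ge0}\|x(n)\|\le\mu\|x(0)\|$. The smallest such $\mu$ is called the overshooting measure and is denoted by $\chi(\mathfrak{A})$. *)

theory Defs
  imports "HOL-Analysis.Analysis"
begin

text \<open>
  The space is \<^typ>\<open>real ^ 'n\<close>. It carries an arbitrary norm \<open>\<nu>\<close>, which is
  unrelated to the Euclidean norm of the type class.
\<close>

definition is_norm :: "(real ^ 'n \<Rightarrow> real) \<Rightarrow> bool" where
  "is_norm \<nu> \<longleftrightarrow>
     (\<forall>x. 0 \<le> \<nu> x) \<and> (\<forall>x. \<nu> x = 0 \<longleftrightarrow> x = 0) \<and>
     (\<forall>c x. \<nu> (c *\<^sub>R x) = \<bar>c\<bar> * \<nu> x) \<and> (\<forall>x y. \<nu> (x + y) \<le> \<nu> x + \<nu> y)"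

definition norm_ball :: "(real ^ 'n \<Rightarrow> real) \<Rightarrow> real \<Rightarrow> (real ^ 'n) set" where
  "norm_ball \<nu> t = {x. \<nu> x \<le> t}"

definition quasi_controllable :: "(real ^ 'n ^ 'n) set \<Rightarrow> bool" where
  "quasi_controllable \<AA> \<longleftrightarrow>
     \<not> (\<exists>V. subspace V \<and> V \<noteq> {0} \<and> V \<noteq> UNIV \<and> (\<forall>A\<in>\<AA>. \<forall>v\<in>V. A *v v \<in> V))"

definition products_upto :: "(real ^ 'n ^ 'n) set \<Rightarrow> nat \<Rightarrow> (real ^ 'n ^ 'n) set" where
  "products_upto \<AA> k =
     {foldr (**) Ls (mat 1) | Ls. length Ls \<le> k \<and> set Ls \<subseteq> \<AA> \<union> {mat 1}}"

definition reach :: "(real ^ 'n ^ 'n) set \<Rightarrow> nat \<Rightarrow> real ^ 'n \<Rightarrow> (real ^ 'n) set" where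
  "reach \<AA> k x = {L *v x | L. L \<in> products_upto \<AA> k}"

definition absco :: "(real ^ 'n) set \<Rightarrow> (real ^ 'n) set" where
  "absco W = convex hull (W \<union> uminus ` W)"

text \<open>
  For a norm \<open>\<nu>\<close> and a finite \<open>\<AA>\<close>, the supremum and the infimum below are those of
  nonempty sets bounded on the relevant side: \<open>t = 0\<close> is always admissible, the
  absolutely convex hull is bounded, and the unit sphere is nonempty. Balls of
  negative radius are empty, so negative \<open>t\<close> do not affect the supremum.
\<close>

definition qc_measure ::
    "(real ^ 'n \<Rightarrow> real) \<Rightarrow> nat \<Rightarrow> (real ^ 'n ^ 'n) set \<Rightarrow> real" where
  "qc_measure \<nu> p \<AA> =
     (INF x\<in>{x. \<nu> x = 1}. Sup {t. norm_ball \<nu> t \<subseteq> absco (reach \<AA> p x)})"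

definition is_solution :: "(nat \<Rightarrow> real ^ 'n ^ 'n) \<Rightarrow> (nat \<Rightarrow> real ^ 'n) \<Rightarrow> bool" where
  "is_solution A x \<longleftrightarrow> (\<forall>n. x (Suc n) = A n *v x n)"

text \<open>
  The condition \<open>sup\<^sub>n \<nu> (x n) \<le> \<mu> * \<nu> (x 0)\<close> is stated termwise because the
  supremum of an unbounded set of reals is unspecified.
\<close>

definition overshoot_bound ::
    "(real ^ 'n \<Rightarrow> real) \<Rightarrow> (real ^ 'n ^ 'n) set \<Rightarrow> real \<Rightarrow> bool" where
  "overshoot_bound \<nu> \<AA> \<mu> \<longleftrightarrow>
     (\<forall>A x. (\<forall>n. A n \<in> \<AA>) \<longrightarrow> is_solution A x \<longrightarrow> (\<forall>n. \<nu> (x n) \<le> \<mu> * \<nu> (x 0)))"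

definition lyapunov_abs_stable ::
    "(real ^ 'n \<Rightarrow> real) \<Rightarrow> (real ^ 'n ^ 'n) set \<Rightarrow> bool" where
  "lyapunov_abs_stable \<nu> \<AA> \<longleftrightarrow> (\<exists>\<mu>. overshoot_bound \<nu> \<AA> \<mu>)"

definition overshoot_measure ::
    "(real ^ 'n \<Rightarrow> real) \<Rightarrow> (real ^ 'n ^ 'n) set \<Rightarrow> real" where
  "overshoot_measure \<nu> \<AA> = (LEAST \<mu>. overshoot_bound \<nu> \<AA> \<mu>)"

text \<open>The least bound exists whenever the equation is stable.\<close>

lemma overshoot_bound_ge_1:
  fixes \<AA> :: "(real ^ 'n ^ 'n) set"
  assumes "is_norm \<nu>" "\<AA> \<noteq> {}" "overshoot_bound \<nu> \<AA> \<mu>"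
  shows "1 \<le> \<mu>"
proof -
  obtain B where B: "B \<in> \<AA>" using assms(2) by blast
  define x where "x = rec_nat (1 :: real ^ 'n) (\<lambda>_ y. B *v y)"
  have "is_solution (\<lambda>_. B) x" by (simp add: is_solution_def x_def)
  then have "\<nu> (x 0) \<le> \<mu> * \<nu> (x 0)"
    using assms(3)[unfolded overshoot_bound_def, rule_format, of "\<lambda>_. B" x 0] B by simp
  moreover have "(1 :: real ^ 'n) \<noteq> 0" by (simp add: vec_eq_iff)
  then have "0 < \<nu> (x 0)"
    using assms(1) unfolding is_norm_def x_def by (simp add: less_le)
  ultimately show ?thesis by simp
qed

lemma overshoot_measure_least:
  fixes \<AA> :: "(real ^ 'n ^ 'n) set"
  assumes "is_norm \<nu>" "\<AA> \<noteq> {}" "lyapunov_abs_stable \<nu> \<AA>"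
  shows "overshoot_bound \<nu> \<AA> (overshoot_measure \<nu> \<AA>)"
    and "overshoot_bound \<nu> \<AA> \<mu> \<Longrightarrow> overshoot_measure \<nu> \<AA> \<le> \<mu>"
proof -
  define m where "m = Inf {\<mu>. overshoot_bound \<nu> \<AA> \<mu>}"
  have ne: "{\<mu>. overshoot_bound \<nu> \<AA> \<mu>} \<noteq> {}"
    using assms(3) by (auto simp: lyapunov_abs_stable_def)
  have bdd: "bdd_below {\<mu>. overshoot_bound \<nu> \<AA> \<mu>}"
    using overshoot_bound_ge_1[OF assms(1,2)] by (intro bdd_belowI[of _ 1]) auto
  have le: "m \<le> \<mu>" if "overshoot_bound \<nu> \<AA> \<mu>" for \<mu>
    using that bdd by (auto simp: m_def intro: cInf_lower)
  have "overshoot_bound \<nu> \<AA> m"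
    unfolding overshoot_bound_def
  proof (intro allI impI)
    fix A x n
    assume A: "\<forall>n. A n \<in> \<AA>" and x: "is_solution A x"
    have bd: "\<nu> (x n) \<le> \<mu> * \<nu> (x 0)" if "overshoot_bound \<nu> \<AA> \<mu>" for \<mu>
      using that A x unfolding overshoot_bound_def by blast
    have nonneg: "0 \<le> \<nu> (x 0)" using assms(1) by (simp add: is_norm_def)
    show "\<nu> (x n) \<le> m * \<nu> (x 0)"
    proof (cases "\<nu> (x 0) = 0")
      case True
      then show ?thesis using bd ne by auto
    next
      case False
      with nonneg have pos: "0 < \<nu> (x 0)" by simp
      have "\<nu> (x n) / \<nu> (x 0) \<le> m"
        unfolding m_def by (rule cInf_greatest[OF ne]) (use bd pos in \<open>auto simp: field_simps\<close>)
      then show ?thesis using pos by (simp add: field_simps)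
    qed
  qed
  then have "overshoot_measure \<nu> \<AA> = m"
    unfolding overshoot_measure_def using le by (intro Least_equality)
  with \<open>overshoot_bound \<nu> \<AA> m\<close> le
  show "overshoot_bound \<nu> \<AA> (overshoot_measure \<nu> \<AA>)"
    and "overshoot_bound \<nu> \<AA> \<mu> \<Longrightarrow> overshoot_measure \<nu> \<AA> \<le> \<mu>" by auto
qed

end

theory Submission
  imports Defs
begin

text \<open>
  Let \<open>\<omega> x\<close> be the supremum of \<open>\<nu> (L x)\<close> over all products \<open>L\<close> of matrices of the family. It does
  not increase along trajectories, so a point \<open>z = L x\<close> at which \<open>\<nu> (L x)\<close> nearly attains \<open>\<omega> x\<close>
  satisfies \<open>\<omega> z \<le> c * \<nu> z\<close> with \<open>c\<close> close to \<open>1\<close>. If the ball of radius \<open>t\<close> lies in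
  the absolutely convex hull of the points reachable from \<open>z / \<nu> z\<close>, then \<open>\<omega>\<close> is bounded by \<open>c\<close>
  on that ball, and hence \<open>t * \<nu> (L w) \<le> c * \<nu> w\<close> for every \<open>L\<close> and \<open>w\<close>.

  The measure is positive because the vectors reachable from \<open>x \<noteq> 0\<close> span the space (the
  dimension of the reachable span grows until it is full), so that the sum of
  \<open>\<bar>L x \<bullet> e\<bar>\<close> over the products \<open>L\<close> is bounded away from zero on the compact product of
  the \<open>\<nu>\<close>-sphere and the Euclidean sphere.
\<close>

section \<open>Norms on a Euclidean space\<close>

context
  fixes \<nu> :: "real ^ 'n \<Rightarrow> real"
  assumes norm: "is_norm \<nu>"
begin

lemma is_norm_nonneg: "0 \<le> \<nu> x"
  and is_norm_eq_0: "\<nu> x = 0 \<longleftrightarrow> x = 0"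
  and is_norm_scaleR: "\<nu> (c *\<^sub>R x) = \<bar>c\<bar> * \<nu> x"
  and is_norm_triangle: "\<nu> (x + y) \<le> \<nu> x + \<nu> y"
  using norm by (auto simp: is_norm_def)

lemma is_norm_pos: "x \<noteq> 0 \<Longrightarrow> 0 < \<nu> x"
  using is_norm_nonneg[of x] is_norm_eq_0[of x] by linarith

lemma is_norm_minus: "\<nu> (- x) = \<nu> x"
  using is_norm_scaleR[of "-1" x] by simp

lemma is_norm_normalize: "x \<noteq> 0 \<Longrightarrow> \<nu> ((1 / \<nu> x) *\<^sub>R x) = 1"
  using is_norm_pos[of x] by (simp add: is_norm_scaleR)

text \<open>Serves continuity: a convex function on an open subset of a Euclidean space is
  continuous.\<close>

lemma is_norm_convex: "convex_on UNIV \<nu>"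
proof (rule convex_onI)
  fix t :: real and x y
  assume "0 < t" "t < 1"
  then show "\<nu> ((1 - t) *\<^sub>R x + t *\<^sub>R y) \<le> (1 - t) * \<nu> x + t * \<nu> y"
    using is_norm_triangle[of "(1 - t) *\<^sub>R x" "t *\<^sub>R y"] by (simp add: is_norm_scaleR)
qed simp

lemma is_norm_continuous: "continuous_on S \<nu>"
  using convex_on_continuous[OF open_UNIV is_norm_convex] continuous_on_subset by blast

text \<open>The factor is the minimum of \<open>\<nu>\<close> on the Euclidean unit sphere, attained
  by compactness; homogeneity carries the bound to every vector.\<close>

lemma is_norm_dominates:
  obtains m where "0 < m" "\<And>x. m * norm x \<le> \<nu> x"
proof -
  have "sphere (0 :: real ^ 'n) 1 \<noteq> {}" by simp
  then obtain u where u: "u \<in> sphere 0 1" "\<forall>x\<in>sphere 0 1. \<nu> u \<le> \<nu> x"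
    using continuous_attains_inf[OF compact_sphere _ is_norm_continuous] by metis
  have "\<nu> u * norm x \<le> \<nu> x" for x
  proof (cases "x = 0")
    case True
    then show ?thesis by (simp add: is_norm_nonneg)
  next
    case False
    then have "(1 / norm x) *\<^sub>R x \<in> sphere 0 1" by simp
    then have "\<nu> u \<le> \<nu> ((1 / norm x) *\<^sub>R x)" using u(2) by blast
    then show ?thesis using False by (simp add: is_norm_scaleR field_simps)
  qed
  moreover have "0 < \<nu> u" using u(1) by (intro is_norm_pos) auto
  ultimately show ?thesis using that by blast
qed

lemma is_norm_compact_sphere: "compact {x. \<nu> x = 1}"
proof -
  obtain m where m: "0 < m" "\<And>x. m * norm x \<le> \<nu> x" using is_norm_dominates by blast
  have "norm x \<le> 1 / m" if "\<nu> x = 1" for x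
    using m(2)[of x] m(1) that by (simp add: field_simps)
  then have "bounded {x. \<nu> x = 1}" by (auto simp: bounded_iff)
  moreover have "closed {x. \<nu> x = 1}"
    by (intro closed_Collect_eq is_norm_continuous continuous_on_const)
  ultimately show ?thesis by (simp add: compact_eq_bounded_closed)
qed

text \<open>Lets a bound on \<open>\<nu> (L *v y)\<close> pass from the generators of an absolutely
  convex hull to the whole hull.\<close>

lemma is_norm_convex_preimage: "convex {y. \<nu> (L *v y) \<le> c}"
proof (rule convexI, clarify)
  fix x y and u v :: real
  assume *: "\<nu> (L *v x) \<le> c" "\<nu> (L *v y) \<le> c" "0 \<le> u" "0 \<le> v" "u + v = 1"
  have "\<nu> (L *v (u *\<^sub>R x + v *\<^sub>R y)) \<le> u * \<nu> (L *v x) + v * \<nu> (L *v y)"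
    using is_norm_triangle[of "u *\<^sub>R (L *v x)" "v *\<^sub>R (L *v y)"] *(3,4)
    by (simp add: matrix_vector_right_distrib matrix_vector_mult_scaleR is_norm_scaleR)
  also have "\<dots> \<le> c" using * by (intro convex_bound_le) auto
  finally show "\<nu> (L *v (u *\<^sub>R x + v *\<^sub>R y)) \<le> c" .
qed

end

section \<open>Products of matrices\<close>

abbreviation mat_prod :: "(real ^ 'n ^ 'n) list \<Rightarrow> real ^ 'n ^ 'n" where
  "mat_prod Ls \<equiv> foldr (**) Ls (mat 1)"

lemma mat_prod_append: "mat_prod (Ls @ Ks) = mat_prod Ls ** mat_prod Ks"
  by (induction Ls) (auto simp: matrix_mul_assoc)

lemma mat_prod_filter: "mat_prod (filter (\<lambda>A. A \<noteq> mat 1) Ls) = mat_prod Ls"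
  by (induction Ls) auto

lemma products_upto_mono: "k \<le> l \<Longrightarrow> products_upto \<AA> k \<subseteq> products_upto \<AA> l"
  by (fastforce simp: products_upto_def)

lemma mat_1_in_products_upto: "mat 1 \<in> products_upto \<AA> k"
  unfolding products_upto_def by (intro CollectI exI[of _ "[]"]) simp

lemma products_upto_Suc:
  assumes "A \<in> \<AA>" "L \<in> products_upto \<AA> k"
  shows "A ** L \<in> products_upto \<AA> (Suc k)"
proof -
  obtain Ls where "L = mat_prod Ls" "length Ls \<le> k" "set Ls \<subseteq> \<AA> \<union> {mat 1}"
    using assms(2) by (auto simp: products_upto_def)
  then show ?thesis unfolding products_upto_def
    using assms(1) by (intro CollectI exI[of _ "A # Ls"]) auto
qed

lemma products_upto_mult:
  assumes "K \<in> products_upto \<AA> k" "L \<in> products_upto \<AA> l"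
  shows "K ** L \<in> products_upto \<AA> (k + l)"
proof -
  obtain Ks where "K = mat_prod Ks" "length Ks \<le> k" "set Ks \<subseteq> \<AA> \<union> {mat 1}"
    using assms(1) by (auto simp: products_upto_def)
  moreover obtain Ls where "L = mat_prod Ls" "length Ls \<le> l" "set Ls \<subseteq> \<AA> \<union> {mat 1}"
    using assms(2) by (auto simp: products_upto_def)
  ultimately show ?thesis unfolding products_upto_def
    by (intro CollectI exI[of _ "Ks @ Ls"]) (auto simp: mat_prod_append simp del: foldr_append)
qed

lemma finite_products_upto:
  assumes "finite \<AA>"
  shows "finite (products_upto \<AA> k)"
proof -
  have "products_upto \<AA> k = mat_prod ` {Ls. set Ls \<subseteq> \<AA> \<union> {mat 1} \<and> length Ls \<le> k}"
    by (auto simp: products_upto_def)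
  then show ?thesis using finite_lists_length_le[of "\<AA> \<union> {mat 1}" k] assms by simp
qed

lemma solution_eq_mat_prod:
  "is_solution A x \<Longrightarrow> x n = mat_prod (rev (map A [0..<n])) *v x 0"
  by (induction n) (simp_all add: is_solution_def flip: matrix_vector_mul_assoc)

lemma is_solution_mat_prod: "is_solution A (\<lambda>n. mat_prod (rev (map A [0..<n])) *v x)"
  by (simp add: is_solution_def flip: matrix_vector_mul_assoc)

lemma overshoot_boundI:
  assumes "\<And>k L x. L \<in> products_upto \<AA> k \<Longrightarrow> \<nu> (L *v x) \<le> \<mu> * \<nu> x"
  shows "overshoot_bound \<nu> \<AA> \<mu>"
  unfolding overshoot_bound_def
proof (intro allI impI)
  fix A x n
  assume A: "\<forall>n. A n \<in> \<AA>" and x: "is_solution A x"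
  have "mat_prod (rev (map A [0..<n])) \<in> products_upto \<AA> n"
    unfolding products_upto_def using A by (intro CollectI exI[of _ "rev (map A [0..<n])"]) auto
  then show "\<nu> (x n) \<le> \<mu> * \<nu> (x 0)"
    using assms solution_eq_mat_prod[OF x, of n] by metis
qed

text \<open>Identity factors are dropped, and what remains of \<open>L\<close> is run as the initial
  piece of a trajectory.\<close>

lemma overshoot_boundD:
  assumes "overshoot_bound \<nu> \<AA> \<mu>" "\<AA> \<noteq> {}" "L \<in> products_upto \<AA> k"
  shows "\<nu> (L *v x) \<le> \<mu> * \<nu> x"
proof -
  obtain B where B: "B \<in> \<AA>" using assms(2) by blast
  obtain Ks where Ks: "L = mat_prod Ks" "set Ks \<subseteq> \<AA> \<union> {mat 1}"
    using assms(3) by (auto simp: products_upto_def)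
  define Ls where "Ls = filter (\<lambda>A. A \<noteq> mat 1) Ks"
  have Ls: "L = mat_prod Ls" "set Ls \<subseteq> \<AA>"
    using Ks by (auto simp: Ls_def mat_prod_filter)
  \<comment> \<open>The rightmost factor acts first, hence \<open>rev\<close>. Once the factors of
    \<open>L\<close> are used up, the fixed member \<open>B\<close> continues the sequence.\<close>
  define A where "A n = (if n < length Ls then rev Ls ! n else B)" for n
  define X where "X n = mat_prod (rev (map A [0..<n])) *v x" for n
  have "A n \<in> \<AA>" for n
    using B Ls(2) nth_mem[of n "rev Ls"] by (auto simp: A_def)
  moreover have "is_solution A X" unfolding X_def by (rule is_solution_mat_prod)
  ultimately have "\<nu> (X (length Ls)) \<le> \<mu> * \<nu> (X 0)"
    using assms(1) unfolding overshoot_bound_def by blast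
  moreover have "map A [0..<length Ls] = rev Ls"
    by (rule nth_equalityI) (auto simp: A_def)
  ultimately show ?thesis by (simp add: X_def Ls(1))
qed

section \<open>Positivity of the measure of quasi-controllability\<close>

lemma reach_mono: "k \<le> l \<Longrightarrow> reach \<AA> k x \<subseteq> reach \<AA> l x"
  using products_upto_mono[of k l \<AA>] by (auto simp: reach_def)

lemma self_in_reach: "x \<in> reach \<AA> k x"
  unfolding reach_def using mat_1_in_products_upto[of \<AA> k]
  by (intro CollectI exI[of _ "mat 1"]) simp

lemma reach_eq_image: "reach \<AA> k x = (\<lambda>L. L *v x) ` products_upto \<AA> k"
  by (auto simp: reach_def)

lemma span_reach_invariant:
  assumes "A \<in> \<AA>" "v \<in> span (reach \<AA> k x)"
  shows "A *v v \<in> span (reach \<AA> (Suc k) x)"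
proof -
  have "A *v w \<in> reach \<AA> (Suc k) x" if "w \<in> reach \<AA> k x" for w
    using that products_upto_Suc[OF assms(1)]
    by (fastforce simp: reach_def matrix_vector_mul_assoc)
  then have "(*v) A ` reach \<AA> k x \<subseteq> reach \<AA> (Suc k) x" by blast
  then have "(*v) A ` span (reach \<AA> k x) \<subseteq> span (reach \<AA> (Suc k) x)"
    unfolding linear_span_image[OF matrix_vector_mul_linear, symmetric] by (rule span_mono)
  then show ?thesis using assms(2) by blast
qed

text \<open>If allowing one more factor does not enlarge the span, the span is invariant under the
  family; it contains \<open>x \<noteq> 0\<close>, so it is everything. The dimension is 1 at
  \<open>k = 0\<close>, which is why \<open>N - 1\<close> factors suffice.\<close>

lemma span_reach_dim:
  assumes "quasi_controllable \<AA>" "x \<noteq> 0"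
  shows "span (reach \<AA> k x) = UNIV \<or> Suc k \<le> dim (span (reach \<AA> k x))"
proof (induction k)
  case 0
  have "dim {x} \<le> dim (span (reach \<AA> 0 x))"
    using self_in_reach[of x \<AA> 0] by (intro dim_subset) (auto intro: span_base)
  then show ?case using assms(2) by simp
next
  case (Suc k)
  let ?V = "span (reach \<AA> k x)" and ?W = "span (reach \<AA> (Suc k) x)"
  have VW: "?V \<subseteq> ?W" by (intro span_mono reach_mono) simp
  show ?case
  proof (cases "?V = UNIV")
    case True
    then show ?thesis using VW by blast
  next
    case False
    have "x \<in> ?V" using self_in_reach by (rule span_base)
    then have "?V \<noteq> {0}" using assms(2) by blast
    with False assms(1) obtain A v where "A \<in> \<AA>" "v \<in> ?V" "A *v v \<notin> ?V"
      unfolding quasi_controllable_def using subspace_span by blast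
    then have "?V \<subset> ?W" using VW span_reach_invariant by blast
    then have "dim ?V < dim ?W" by (intro dim_psubset) (simp add: span_span)
    then show ?thesis using Suc.IH False by linarith
  qed
qed

lemma span_reach_eq_UNIV:
  fixes x :: "real ^ 'n"
  assumes "quasi_controllable \<AA>" "x \<noteq> 0" "CARD('n) - 1 \<le> p"
  shows "span (reach \<AA> p x) = UNIV"
proof -
  have "Suc p \<le> dim (span (reach \<AA> p x)) \<Longrightarrow> dim (span (reach \<AA> p x)) = DIM(real ^ 'n)"
    using assms(3) dim_subset_UNIV[of "span (reach \<AA> p x)"] by simp
  then show ?thesis
    using span_reach_dim[OF assms(1,2), of p] dim_eq_full[of "span (reach \<AA> p x)"]
    by (auto simp: span_span)
qed

lemma compact_absco_reach: "finite \<AA> \<Longrightarrow> compact (absco (reach \<AA> p x))"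
  unfolding absco_def reach_eq_image
  by (intro compact_convex_hull finite_imp_compact) (simp add: finite_products_upto)

text \<open>A point outside the closed hull is cut off by a hyperplane, and the hypothesis on
  \<open>r\<close> forces such a hyperplane to lie farther than \<open>r\<close> from the
  origin.\<close>

lemma ball_subset_absco:
  assumes "finite W" "W \<noteq> {}" and r: "\<And>e. norm e = 1 \<Longrightarrow> \<exists>w\<in>W. r \<le> \<bar>w \<bullet> e\<bar>"
    and "norm y < r"
  shows "y \<in> absco W"
proof (rule ccontr)
  assume y: "y \<notin> absco W"
  have "closed (absco W)" unfolding absco_def
    using assms(1) by (intro compact_imp_closed compact_convex_hull finite_imp_compact) simp
  then obtain a b where ab: "a \<bullet> y < b" "\<forall>x\<in>absco W. b < a \<bullet> x"
    using separating_hyperplane_closed_point[of "absco W" y] y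
    by (auto simp: absco_def convex_convex_hull)
  obtain w0 where "w0 \<in> W" using assms(2) by blast
  then have "w0 \<in> absco W" by (auto simp: absco_def intro: hull_inc)
  \<comment> \<open>A zero normal would give \<open>0 < b\<close> from \<open>y\<close> and
    \<open>b < 0\<close> from \<open>w0\<close>.\<close>
  then have "a \<noteq> 0" using ab by force
  then obtain w where w: "w \<in> W" "r \<le> \<bar>w \<bullet> ((1 / norm a) *\<^sub>R a)\<bar>"
    using r[of "(1 / norm a) *\<^sub>R a"] by auto
  then have "r * norm a \<le> \<bar>w \<bullet> a\<bar>" using \<open>a \<noteq> 0\<close> by (simp add: field_simps)
  moreover have "w \<in> absco W" "- w \<in> absco W"
    using w(1) by (auto simp: absco_def intro: hull_inc)
  then have "b < a \<bullet> w" "b < a \<bullet> (- w)" using ab(2) by blast+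
  \<comment> \<open>One of \<open>w\<close> and \<open>- w\<close> has inner product
    \<open>- \<bar>w \<bullet> a\<bar>\<close> with \<open>a\<close>.\<close>
  ultimately have "b < - (r * norm a)" by (auto simp: inner_commute abs_if split: if_splits)
  moreover have "- (norm a * norm y) \<le> a \<bullet> y"
    using Cauchy_Schwarz_ineq2[of a y] by linarith
  ultimately have "r * norm a < norm a * norm y" using ab(1) by linarith
  then show False using assms(4) \<open>a \<noteq> 0\<close> by (simp add: mult.commute)
qed

lemma uniform_norm_ball_subset:
  fixes \<AA> :: "(real ^ 'n ^ 'n) set"
  assumes "is_norm \<nu>" "finite \<AA>" "quasi_controllable \<AA>" "CARD('n) - 1 \<le> p"
  obtains t where "0 < t" "\<And>x. \<nu> x = 1 \<Longrightarrow> norm_ball \<nu> t \<subseteq> absco (reach \<AA> p x)"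
proof -
  let ?P = "products_upto \<AA> p"
  let ?C = "{x. \<nu> x = 1} \<times> sphere (0 :: real ^ 'n) 1"
  \<comment> \<open>The sum is jointly continuous in point and direction, and it vanishes only if
    the direction is orthogonal to every reachable vector.\<close>
  define h where "h z = (\<Sum>L\<in>?P. \<bar>(L *v fst z) \<bullet> snd z\<bar>)" for z :: "(real ^ 'n) \<times> (real ^ 'n)"
  note fin = finite_products_upto[OF assms(2), of p]
  have Pne: "?P \<noteq> {}" using mat_1_in_products_upto by blast
  have "compact ?C" by (intro compact_Times is_norm_compact_sphere assms(1) compact_sphere)
  moreover have "?C \<noteq> {}"
    using is_norm_normalize[OF assms(1), of 1] by (auto simp: vec_eq_iff)
  moreover have "continuous_on ?C h" unfolding h_def
    by (intro continuous_intros linear_continuous_on_compose[where f = fst] matrix_vector_mul_linear)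
  ultimately obtain z where z: "z \<in> ?C" "\<forall>z'\<in>?C. h z \<le> h z'"
    using continuous_attains_inf by metis
  have "h z \<noteq> 0"
  proof
    assume "h z = 0"
    then have "\<forall>L\<in>?P. (L *v fst z) \<bullet> snd z = 0"
      unfolding h_def using fin by (simp add: sum_nonneg_eq_0_iff)
    then have "orthogonal (snd z) w" if "w \<in> reach \<AA> p (fst z)" for w
      using that by (auto simp: reach_def orthogonal_def inner_commute)
    then have "orthogonal (snd z) w" if "w \<in> span (reach \<AA> p (fst z))" for w
      using that orthogonal_to_span by blast
    moreover have "fst z \<noteq> 0" using z(1) is_norm_eq_0[OF assms(1), of "fst z"] by auto
    ultimately have "orthogonal (snd z) (snd z)"
      using span_reach_eq_UNIV[OF assms(3) _ assms(4)] by blast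
    then show False using z(1) by (auto simp: orthogonal_def)
  qed
  moreover have "0 \<le> h z" unfolding h_def by (simp add: sum_nonneg)
  ultimately have hz: "0 < h z" by simp
  \<comment> \<open>The average summand at the minimum: if all summands at \<open>(x, e)\<close>
    were below \<open>r\<close>, then \<open>h (x, e)\<close> would be below
    \<open>h z\<close>.\<close>
  define r where "r = h z / card ?P"
  have card: "0 < card ?P" using fin Pne by (simp add: card_gt_0_iff)
  then have "0 < r" using hz by (simp add: r_def)
  obtain m where m: "0 < m" "\<And>x. m * norm x \<le> \<nu> x" using is_norm_dominates[OF assms(1)] by blast
  show ?thesis
  proof
    \<comment> \<open>The factor \<open>m\<close> converts a \<open>\<nu>\<close>-radius into a
      Euclidean one; halving yields the strict inequality \<open>norm y < r\<close>.\<close>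
    show "0 < m * r / 2" using \<open>0 < r\<close> m(1) by simp
    fix x assume x: "\<nu> x = 1"
    show "norm_ball \<nu> (m * r / 2) \<subseteq> absco (reach \<AA> p x)"
    proof
      fix y assume "y \<in> norm_ball \<nu> (m * r / 2)"
      then have "m * norm y \<le> m * (r / 2)" using m(2)[of y] by (simp add: norm_ball_def)
      then have "norm y \<le> r / 2" using m(1) by (simp only: mult_le_cancel_left_pos)
      then have y: "norm y < r" using \<open>0 < r\<close> by simp
      have "\<exists>w\<in>reach \<AA> p x. r \<le> \<bar>w \<bullet> e\<bar>" if "norm e = 1" for e
      proof (rule ccontr)
        assume "\<not> ?thesis"
        then have "\<bar>(L *v x) \<bullet> e\<bar> < r" if "L \<in> ?P" for L
          using that by (force simp: reach_def)
        then have "h (x, e) < (\<Sum>L\<in>?P. r)"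
          unfolding h_def using fin Pne by (intro sum_strict_mono) auto
        also have "\<dots> = h z" using card by (simp add: r_def)
        also have "\<dots> \<le> h (x, e)" using z(2) x that by simp
        finally show False by simp
      qed
      then show "y \<in> absco (reach \<AA> p x)"
        using y fin Pne by (intro ball_subset_absco[where r = r]) (auto simp: reach_eq_image)
    qed
  qed
qed

text \<open>Makes the supremum in \<open>qc_measure\<close> meaningful: a \<open>\<nu>\<close>-unit
  vector scaled by \<open>t\<close> lies in \<open>W\<close>, where \<open>\<nu>\<close> is
  bounded.\<close>

lemma bdd_above_norm_ball_subset:
  fixes W :: "(real ^ 'n) set"
  assumes "is_norm \<nu>" "compact W"
  shows "bdd_above {t. norm_ball \<nu> t \<subseteq> W}"
proof -
  have "bdd_above (\<nu> ` W)"
    using compact_continuous_image[OF is_norm_continuous[OF assms(1)] assms(2)]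
    by (intro bounded_imp_bdd_above compact_imp_bounded)
  then obtain b where b: "\<And>y. y \<in> W \<Longrightarrow> \<nu> y \<le> b" by (auto simp: bdd_above_def)
  obtain u where u: "\<nu> u = 1"
    using is_norm_normalize[OF assms(1), of 1] by (auto simp: vec_eq_iff)
  have "t \<le> max 0 b" if "norm_ball \<nu> t \<subseteq> W" for t
  proof (cases "t \<le> 0")
    case False
    then have "\<nu> (t *\<^sub>R u) = t" using u by (simp add: is_norm_scaleR[OF assms(1)])
    moreover from this have "t *\<^sub>R u \<in> W" using that by (auto simp: norm_ball_def)
    ultimately show ?thesis using b[of "t *\<^sub>R u"] by simp
  qed simp
  then show ?thesis by (intro bdd_aboveI) auto
qed

text \<open>A radius strictly below the measure is exceeded by an admissible one, and balls are
  nested; so no supremum has to be attained. The uniform radius \<open>s\<close> gives positivity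
  and bounds the infimum from below.\<close>

lemma
  fixes \<AA> :: "(real ^ 'n ^ 'n) set"
  assumes "is_norm \<nu>" "finite \<AA>" "quasi_controllable \<AA>" "CARD('n) - 1 \<le> p"
  shows qc_measure_pos: "0 < qc_measure \<nu> p \<AA>"
    and norm_ball_subset_absco_reach: "\<And>t x. t < qc_measure \<nu> p \<AA> \<Longrightarrow> \<nu> x = 1 \<Longrightarrow> norm_ball \<nu> t \<subseteq> absco (reach \<AA> p x)"
proof -
  let ?T = "\<lambda>x. {t. norm_ball \<nu> t \<subseteq> absco (reach \<AA> p x)}"
  obtain s where s: "0 < s" "\<And>x. \<nu> x = 1 \<Longrightarrow> s \<in> ?T x"
    by (rule uniform_norm_ball_subset[OF assms]) simp
  have sup: "s \<le> Sup (?T x)" if "\<nu> x = 1" for x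
    using s(2)[OF that] bdd_above_norm_ball_subset[OF assms(1) compact_absco_reach[OF assms(2)]]
    by (rule cSup_upper)
  have "{x. \<nu> x = 1} \<noteq> {}"
    using is_norm_normalize[OF assms(1), of 1] by (auto simp: vec_eq_iff)
  then have "s \<le> qc_measure \<nu> p \<AA>" unfolding qc_measure_def
    using sup by (intro cINF_greatest) auto
  then show "0 < qc_measure \<nu> p \<AA>" using s(1) by simp
  fix t x assume t: "t < qc_measure \<nu> p \<AA>" and x: "\<nu> x = 1"
  have "qc_measure \<nu> p \<AA> \<le> Sup (?T x)" unfolding qc_measure_def
    using sup x by (intro cINF_lower bdd_belowI2[of _ s]) auto
  with t have "t < Sup (?T x)" by simp
  moreover have "?T x \<noteq> {}" using s(2)[OF x] by blast
  ultimately obtain t' where "t' \<in> ?T x" "t < t'" using less_cSupE by metis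
  then show "norm_ball \<nu> t \<subseteq> absco (reach \<AA> p x)" by (auto simp: norm_ball_def)
qed

section \<open>The overshooting bound\<close>

text \<open>The slack \<open>c > 1\<close> makes up for a supremum \<open>\<omega> w\<close> that
  need not be attained; stability enters through the finiteness of \<open>\<omega>\<close>.\<close>

lemma product_bound_of_norm_ball:
  fixes \<AA> :: "(real ^ 'n ^ 'n) set"
  assumes \<nu>: "is_norm \<nu>" and "\<AA> \<noteq> {}" and \<mu>: "overshoot_bound \<nu> \<AA> \<mu>"
    and t: "0 < t" "\<And>x. \<nu> x = 1 \<Longrightarrow> norm_ball \<nu> t \<subseteq> absco (reach \<AA> p x)"
    and K: "K \<in> products_upto \<AA> k" and c: "1 < c"
  shows "t * \<nu> (K *v w) \<le> c * \<nu> w"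
proof (cases "w = 0")
  case True
  then show ?thesis using is_norm_eq_0[OF \<nu>, of 0] by simp
next
  case False
  define P where "P = (\<Union>k. products_upto \<AA> k)"
  define \<omega> where "\<omega> x = (SUP L\<in>P. \<nu> (L *v x))" for x
  have P1: "mat 1 \<in> P" using mat_1_in_products_upto by (auto simp: P_def)
  have Pmult: "L ** M \<in> P" if "L \<in> P" "M \<in> P" for L M
    using that products_upto_mult by (fastforce simp: P_def)
  have bdd: "bdd_above ((\<lambda>L. \<nu> (L *v x)) ` P)" for x
    using overshoot_boundD[OF \<mu> assms(2)] by (intro bdd_aboveI2[of _ _ "\<mu> * \<nu> x"]) (auto simp: P_def)
  have le_\<omega>: "\<nu> (L *v x) \<le> \<omega> x" if "L \<in> P" for L x
    unfolding \<omega>_def using that bdd by (rule cSUP_upper)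
  have \<omega>_le: "\<omega> x \<le> b" if "\<And>L. L \<in> P \<Longrightarrow> \<nu> (L *v x) \<le> b" for x b
    unfolding \<omega>_def using P1 that by (intro cSUP_least) auto
  have \<omega>_mult: "\<omega> (M *v x) \<le> \<omega> x" if "M \<in> P" for M x
  proof (rule \<omega>_le)
    fix L assume "L \<in> P"
    then show "\<nu> (L *v (M *v x)) \<le> \<omega> x"
      using le_\<omega>[OF Pmult[OF _ that]] by (simp add: matrix_vector_mul_assoc)
  qed
  have w_pos: "0 < \<nu> w" using False is_norm_pos[OF \<nu>] by blast
  then have "0 < \<omega> w" using le_\<omega>[OF P1, of w] by simp
  then have "\<omega> w / c < \<omega> w" using c by (simp add: field_simps)
  then have "\<exists>L\<in>P. \<omega> w / c < \<nu> (L *v w)"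
    unfolding \<omega>_def[of w] using less_cSUP_iff[OF _ bdd[of w]] P1 by blast
  then obtain M where M: "M \<in> P" "\<omega> w / c < \<nu> (M *v w)" by blast
  define z where "z = M *v w"
  have "0 < \<omega> w / c" using \<open>0 < \<omega> w\<close> c by simp
  then have z_pos: "0 < \<nu> z" using M(2) by (simp add: z_def)
  have "\<omega> w < c * \<nu> z" using M(2) c by (simp add: z_def field_simps)
  \<comment> \<open>Chains \<open>\<omega> z \<le> \<omega> w < c * \<nu> z\<close>.\<close>
  then have \<omega>z: "\<omega> z \<le> c * \<nu> z" using \<omega>_mult[OF M(1), of w] by (simp add: z_def)
  define x where "x = (1 / \<nu> z) *\<^sub>R z"
  have "z \<noteq> 0" using z_pos is_norm_eq_0[OF \<nu>, of z] by auto
  then have x: "\<nu> x = 1" unfolding x_def by (rule is_norm_normalize[OF \<nu>])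
  have x_le: "\<nu> (L *v x) \<le> c" if "L \<in> P" for L
    using le_\<omega>[OF that, of z] \<omega>z z_pos
    by (simp add: x_def matrix_vector_mult_scaleR is_norm_scaleR[OF \<nu>] field_simps)
  have KP: "K \<in> P" using K by (auto simp: P_def)
  \<comment> \<open>The right-hand set is convex, so containing these generators it contains their
    hull, and with it the ball of radius \<open>t\<close>.\<close>
  have "reach \<AA> p x \<union> uminus ` reach \<AA> p x \<subseteq> {y. \<nu> (K *v y) \<le> c}"
  proof -
    have "\<nu> (K *v (L *v x)) \<le> c" if "L \<in> products_upto \<AA> p" for L
      using x_le[OF Pmult[OF KP]] that by (auto simp: P_def matrix_vector_mul_assoc)
    moreover have "K *v (- y) = - (K *v y)" for y
      by (rule linear_neg[OF matrix_vector_mul_linear])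
    ultimately show ?thesis by (auto simp: reach_def is_norm_minus[OF \<nu>])
  qed
  then have "absco (reach \<AA> p x) \<subseteq> {y. \<nu> (K *v y) \<le> c}"
    unfolding absco_def by (intro hull_minimal is_norm_convex_preimage[OF \<nu>])
  moreover have "(t / \<nu> w) *\<^sub>R w \<in> norm_ball \<nu> t"
    using w_pos t(1) by (simp add: norm_ball_def is_norm_scaleR[OF \<nu>])
  ultimately have "\<nu> (K *v ((t / \<nu> w) *\<^sub>R w)) \<le> c" using t(2)[OF x] by blast
  then show ?thesis using w_pos t(1)
    by (simp add: matrix_vector_mult_scaleR is_norm_scaleR[OF \<nu>] field_simps)
qed

theorem theorem4:
  fixes \<AA> :: "(real ^ 'n ^ 'n) set"
    and \<nu> :: "real ^ 'n \<Rightarrow> real"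
    and p :: nat
  assumes "is_norm \<nu>"
    and "finite \<AA>" and "\<AA> \<noteq> {}"
    and "quasi_controllable \<AA>"
    and "lyapunov_abs_stable \<nu> \<AA>"
    and "1 \<le> p" and "CARD('n) - 1 \<le> p"
  shows "overshoot_measure \<nu> \<AA> \<le> 1 / qc_measure \<nu> p \<AA>"
proof -
  let ?\<sigma> = "qc_measure \<nu> p \<AA>"
  obtain \<mu> where \<mu>: "overshoot_bound \<nu> \<AA> \<mu>" using assms(5) by (auto simp: lyapunov_abs_stable_def)
  note pos = qc_measure_pos[OF assms(1,2,4,7)]
    and ball = norm_ball_subset_absco_reach[OF assms(1,2,4,7)]
  have "overshoot_bound \<nu> \<AA> (1 / ?\<sigma>)"
  proof (rule overshoot_boundI)
    fix k K w assume K: "K \<in> products_upto \<AA> k"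
    have "t * \<nu> (K *v w) \<le> \<nu> w" if "0 < t" "t < ?\<sigma>" for t
    \<comment> \<open>First limit: the slack \<open>c = 1 / s\<close> tends to 1 while
      \<open>t\<close> stays fixed.\<close>
    proof (rule field_le_mult_one_interval)
      fix s :: real assume s: "0 < s" "s < 1"
      then have "t * \<nu> (K *v w) \<le> (1 / s) * \<nu> w"
        using product_bound_of_norm_ball[OF assms(1,3) \<mu> that(1) ball[OF that(2)] K, of "1 / s"] by simp
      then show "s * (t * \<nu> (K *v w)) \<le> \<nu> w" using s by (simp add: field_simps)
    qed
    \<comment> \<open>Second limit: the radius \<open>t = s * ?\<sigma>\<close> tends to the measure
      itself.\<close>
    then have s: "(s * ?\<sigma>) * \<nu> (K *v w) \<le> \<nu> w" if "0 < s" "s < 1" for s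
      using that pos by simp
    have "?\<sigma> * \<nu> (K *v w) \<le> \<nu> w"
      by (rule field_le_mult_one_interval) (use s in \<open>simp add: mult.assoc\<close>)
    then show "\<nu> (K *v w) \<le> 1 / ?\<sigma> * \<nu> w" using pos by (simp add: field_simps)
  qed
  then show ?thesis by (rule overshoot_measure_least(2)[OF assms(1,3,5)])
qed

end
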